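(* Let $x$ be a positive integer and $n\ge 0$. The number $\kappa_n$ of kernel positions of rank $n$ in the polynomial Bernoulli game of the second kind indexed by $x$ is $$\kappa_n=\sum_{m=0}^{n-1}\binom{x+m-2}{m}m!(m+1)!\sum_{k=0}^{n-m-1}\sum_{m=i_0<i_1<\cdots<i_{k+1}=n}\prod_{j=0}^k (i_{j+1}-i_j-1)!^2\binom{i_{j+1}}{i_j+1}\binom{i_{j+1}+1}{i_j}\;+\;\binom{x+n-2}{n}n!(n+1)!.$$
   Context: The polynomial Bernoulli game of the second kind indexed by $x$: positions of rank $n\ge0$ are triples of words $(u_1\cdots u_n,v_1\cdots v_n,w_1\cdots w_n)$ of positive integers with $1\le u_i\le i$, $1\le v_i\le i+1$, $1\le w_i\le x$ for all $i$, and $w_1\le w_2\le\cdots\le w_n$. A valid move replaces the triple by $(u_1\cdots u_m,v_1\cdots v_m,w_1\cdots w_m)$ for some $0\le m<n$ with $w_{m+1}=\cdots=w_n=x$ and $u_{m+1}<v_j$ for all $j=m+1,\ldots,n$. Players alternate; a player unable to move loses; kernel positions are positions of Grundy number zero (every valid move from them leads to a non-kernel position). Binomial coefficients $\binom{a}{m}$ are $a(a-1)\cdots(a-m+1)/m!$. *)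

theory Defs
  imports Complex_Main
begin

type_synonym position = "nat list \<times> nat list \<times> nat list"

text \<open>The letter \<open>u\<^sub>i\<close> of a word (counted from \<open>i = 1\<close>) is the list entry \<open>u ! (i - 1)\<close>.\<close>

definition positions :: "nat \<Rightarrow> nat \<Rightarrow> position set" where
  "positions x n = {(u, v, w).
     length u = n \<and> length v = n \<and> length w = n \<and>
     (\<forall>i\<in>{1..n}. 1 \<le> u ! (i - 1) \<and> u ! (i - 1) \<le> i) \<and>
     (\<forall>i\<in>{1..n}. 1 \<le> v ! (i - 1) \<and> v ! (i - 1) \<le> i + 1) \<and>
     (\<forall>i\<in>{1..n}. 1 \<le> w ! (i - 1) \<and> w ! (i - 1) \<le> x) \<and>
     sorted w}"

fun moves :: "nat \<Rightarrow> position \<Rightarrow> position set" where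
  "moves x (u, v, w) =
     {(take m u, take m v, take m w) | m.
        m < length u \<and>
        (\<forall>j\<in>{m + 1..length u}. w ! (j - 1) = x) \<and>
        (\<forall>j\<in>{m + 1..length u}. u ! m < v ! (j - 1))}"

lemma moves_shorter: "q \<in> moves x p \<Longrightarrow> length (fst q) < length (fst p)"
  by (cases p) auto

function grundy :: "nat \<Rightarrow> position \<Rightarrow> nat" where
  "grundy x p = (LEAST g. g \<notin> grundy x ` moves x p)"
  by pat_completeness auto
termination
  by (relation "measure (\<lambda>(x, p). length (fst p))") (simp_all add: moves_shorter)

declare grundy.simps [simp del]

definition kernel_positions :: "nat \<Rightarrow> nat \<Rightarrow> position set" where
  "kernel_positions x n = {p \<in> positions x n. grundy x p = 0}"

lemma moves_positions:
  assumes "p \<in> positions x n" and "q \<in> moves x p"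
  shows "\<exists>m<n. q \<in> positions x m"
proof -
  obtain u v w where p: "p = (u, v, w)" by (cases p) auto
  obtain m where "m < n" "q = (take m u, take m v, take m w)"
    using assms unfolding p by (auto simp: positions_def)
  moreover have "(take m u, take m v, take m w) \<in> positions x m"
    using assms(1) \<open>m < n\<close> unfolding p by (auto simp: positions_def sorted_wrt_take)
  ultimately show ?thesis by blast
qed

lemma finite_moves: "finite (moves x p)"
proof (cases p)
  case (fields u v w)
  have "moves x p \<subseteq> (\<lambda>m. (take m u, take m v, take m w)) ` {..<length u}"
    unfolding fields by auto
  then show ?thesis by (rule finite_subset) simp
qed

lemma grundy_eq_0_iff: "grundy x p = 0 \<longleftrightarrow> (\<forall>q\<in>moves x p. grundy x q \<noteq> 0)"
proof
  assume "grundy x p = 0"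
  moreover have "grundy x p \<notin> grundy x ` moves x p"
  proof -
    have "\<exists>g. g \<notin> grundy x ` moves x p"
      by (rule ex_new_if_finite) (simp_all add: finite_moves)
    then have "(LEAST g. g \<notin> grundy x ` moves x p) \<notin> grundy x ` moves x p"
      by (rule LeastI_ex)
    then show ?thesis by (subst (1) grundy.simps)
  qed
  ultimately show "\<forall>q\<in>moves x p. grundy x q \<noteq> 0" by force
next
  assume "\<forall>q\<in>moves x p. grundy x q \<noteq> 0"
  then have "0 \<notin> grundy x ` moves x p" by force
  then show "grundy x p = 0" by (subst grundy.simps) (rule Least_eq_0)
qed

lemma finite_positions: "finite (positions x n)"
proof -
  let ?L = "\<lambda>b. {l :: nat list. set l \<subseteq> {..b} \<and> length l = n}"
  have aux: "l \<in> ?L b"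
    if len: "length l = n" and bd: "\<forall>i\<in>{1..n}. l ! (i - 1) \<le> b" for l :: "nat list" and b
  proof -
    have "a \<le> b" if a: "a \<in> set l" for a
    proof -
      obtain i where "i < n" "a = l ! i" using a len by (auto simp: in_set_conv_nth)
      then show ?thesis using bd[rule_format, of "Suc i"] by simp
    qed
    then show ?thesis using len by auto
  qed
  have "positions x n \<subseteq> ?L n \<times> ?L (n + 1) \<times> ?L x"
  proof
    fix p assume "p \<in> positions x n"
    then obtain u v w where p: "p = (u, v, w)"
      and len: "length u = n" "length v = n" "length w = n"
      and u: "\<forall>i\<in>{1..n}. u ! (i - 1) \<le> i"
      and v: "\<forall>i\<in>{1..n}. v ! (i - 1) \<le> i + 1"
      and w: "\<forall>i\<in>{1..n}. w ! (i - 1) \<le> x"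
      unfolding positions_def by blast
    have "u \<in> ?L n" using u by (intro aux len) (meson atLeastAtMost_iff le_trans)
    moreover have "v \<in> ?L (n + 1)" using v by (intro aux len) (meson atLeastAtMost_iff le_trans add_le_mono1)
    moreover have "w \<in> ?L x" using w by (intro aux len)
    ultimately show "p \<in> ?L n \<times> ?L (n + 1) \<times> ?L x" unfolding p by blast
  qed
  then show ?thesis
    by (rule finite_subset) (intro finite_cartesian_product finite_lists_length_eq finite_atMost)
qed

text \<open>Index sequences \<open>m = i\<^sub>0 < i\<^sub>1 < \<dots> < i\<^bsub>k+1\<^esub> = n\<close>, as lists of length \<open>k + 2\<close>.\<close>

definition index_chains :: "nat \<Rightarrow> nat \<Rightarrow> nat \<Rightarrow> nat list set" where
  "index_chains k m n = {i. length i = k + 2 \<and> sorted_wrt (<) i \<and> i ! 0 = m \<and> i ! (k + 1) = n}"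

lemma finite_index_chains: "finite (index_chains k m n)"
proof -
  have "index_chains k m n \<subseteq> {i. set i \<subseteq> {..n} \<and> length i = k + 2}"
  proof
    fix i assume i: "i \<in> index_chains k m n"
    have "a \<le> n" if a: "a \<in> set i" for a
    proof -
      obtain j where "j < k + 2" "a = i ! j"
        using a i by (auto simp: index_chains_def in_set_conv_nth)
      moreover have "sorted i" using i by (auto simp: index_chains_def strict_sorted_imp_sorted)
      ultimately show ?thesis
        using i sorted_nth_mono[of i j "k + 1"] by (auto simp: index_chains_def)
    qed
    then show "i \<in> {i. set i \<subseteq> {..n} \<and> length i = k + 2}"
      using i by (auto simp: index_chains_def)
  qed
  then show ?thesis
    by (rule finite_subset) (rule finite_lists_length_eq, simp)
qed

end

theory Submission
  imports Defs
begin

text \<open>Fix the number \<open>m\<close> of letters of \<open>w\<close> that differ from \<open>x\<close>; they form one of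
  \<open>(x + m - 2) choose m\<close> sorted words, and no move goes below rank \<open>m\<close>. Moves only take
  prefixes, and once a kernel prefix of length \<open>a\<close> is unreachable from some rank it stays
  unreachable from all higher ranks. Hence the kernel prefix following the one of length \<open>a\<close> is at the
  first \<open>b > a\<close> with \<open>v\<^sub>b \<le> u\<^bsub>a+1\<^esub>\<close>, and a kernel position is the same as a chain
  \<open>m = i\<^sub>0 < \<dots> < i\<^bsub>k+1\<^esub> = n\<close> of kernel prefixes with independently chosen blocks in between.
  Counting a block from \<open>a\<close> to \<open>b\<close> by the value \<open>t = u\<^bsub>a+1\<^esub>\<close> gives a factor
  \<open>b! / (a + 1)!\<close> for \<open>u\<close> and, by a weighted hockey-stick identity,
  \<open>(b - a - 1)! * ((b + 1) choose a)\<close> for \<open>v\<close>.\<close>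

section \<open>Words with a prescribed alphabet for each letter\<close>

text \<open>Indices start at 0, so the bounds \<open>i\<close> and \<open>i + 1\<close> on the
  \<open>i\<close>-th letters of \<open>u\<close> and \<open>v\<close> become the alphabets
  \<open>{1..i + 1}\<close> and \<open>{1..i + 2}\<close> at index \<open>i\<close>.\<close>

definition words :: "(nat \<Rightarrow> nat set) \<Rightarrow> nat \<Rightarrow> nat list set" where
  "words A k = {l. length l = k \<and> (\<forall>i<k. l ! i \<in> A i)}"

lemma words_0: "words A 0 = {[]}"
  by (auto simp: words_def)

lemma words_append:
  "words A (a + d) = (\<lambda>(l, l'). l @ l') ` (words A a \<times> words (\<lambda>i. A (a + i)) d)"
proof (intro subset_antisym subsetI)
  fix l assume l: "l \<in> words A (a + d)"
  have "take a l \<in> words A a" "drop a l \<in> words (\<lambda>i. A (a + i)) d"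
    using l by (auto simp: words_def)
  then show "l \<in> (\<lambda>(l, l'). l @ l') ` (words A a \<times> words (\<lambda>i. A (a + i)) d)"
    by (intro image_eqI[where x = "(take a l, drop a l)"]) auto
next
  fix l assume "l \<in> (\<lambda>(l, l'). l @ l') ` (words A a \<times> words (\<lambda>i. A (a + i)) d)"
  then obtain p q where l: "l = p @ q" and p: "p \<in> words A a"
    and q: "q \<in> words (\<lambda>i. A (a + i)) d" by auto
  have "l ! i \<in> A i" if "i < a + d" for i
  proof (cases "i < a")
    case True
    then show ?thesis using p by (auto simp: l words_def nth_append)
  next
    case False
    moreover have "i - a < d" using False that by simp
    ultimately have "q ! (i - a) \<in> A (a + (i - a))"
      using q by (simp only: words_def mem_Collect_eq)
    then show ?thesis using False p by (simp add: l words_def nth_append)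
  qed
  then show "l \<in> words A (a + d)"
    using p q by (auto simp: words_def l)
qed

lemma words_Suc: "words A (Suc k) = (\<lambda>(l, s). l @ [s]) ` (words A k \<times> A k)"
proof -
  have "words (\<lambda>i. A (k + i)) 1 = (\<lambda>s. [s]) ` A k"
    by (auto simp: words_def length_Suc_conv)
  then show ?thesis
    using words_append[of A k 1] by (auto simp: image_iff)
qed

lemma card_words: "card (words A k) = (\<Prod>i<k. card (A i))"
proof (induction k)
  case 0
  then show ?case by (simp add: words_0)
next
  case (Suc k)
  have "inj_on (\<lambda>(l, s). l @ [s]) (words A k \<times> A k)"
    by (auto simp: inj_on_def)
  then show ?case
    using Suc by (simp add: words_Suc card_image card_cartesian_product)
qed

lemma finite_words: "(\<And>i. i < k \<Longrightarrow> finite (A i)) \<Longrightarrow> finite (words A k)"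
  by (induction k) (auto simp: words_0 words_Suc)

section \<open>Counting weakly increasing words\<close>

definition sorted_words :: "nat \<Rightarrow> nat \<Rightarrow> nat list set" where
  "sorted_words y m = {w. length w = m \<and> sorted w \<and> set w \<subseteq> {1..y}}"

lemma finite_sorted_words: "finite (sorted_words y m)"
  by (rule finite_subset[OF _ finite_lists_length_eq[of "{1..y}" m]])
     (auto simp: sorted_words_def)

lemma sorted_words_Suc_Suc:
  "sorted_words (Suc y) (Suc m) =
     (\<lambda>w. w @ [Suc y]) ` sorted_words (Suc y) m \<union> sorted_words y (Suc m)"
proof (intro subset_antisym subsetI)
  fix w assume w: "w \<in> sorted_words (Suc y) (Suc m)"
  then obtain w' b where wb: "w = w' @ [b]"
    by (cases w rule: rev_cases) (auto simp: sorted_words_def)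
  show "w \<in> (\<lambda>w. w @ [Suc y]) ` sorted_words (Suc y) m \<union> sorted_words y (Suc m)"
  proof (cases "b = Suc y")
    case True
    then show ?thesis using w unfolding wb by (auto simp: sorted_words_def sorted_append)
  next
    case False
    then have "b \<le> y" using w unfolding wb by (auto simp: sorted_words_def)
    then have "w \<in> sorted_words y (Suc m)"
      using w unfolding wb by (fastforce simp: sorted_words_def sorted_append)
    then show ?thesis ..
  qed
qed (fastforce simp: sorted_words_def sorted_append)

text \<open>Pascal's rule: a nonempty word over \<open>{1..Suc y}\<close> either ends in
  \<open>Suc y\<close>, and dropping that letter shortens it, or uses only letters up to
  \<open>y\<close>. The generalized binomial is needed because the upper argument is -1 for
  \<open>y = m = 0\<close>.\<close>

lemma card_sorted_words:
  "real (card (sorted_words y m)) = (real y + real m - 1) gchoose m"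
proof (induction y arbitrary: m)
  case 0
  have "sorted_words 0 m = (if m = 0 then {[]} else {})"
    by (auto simp: sorted_words_def)
  \<comment> \<open>Over the empty alphabet only the empty word exists, so the formula must vanish
    for every positive length.\<close>
  moreover have "(real (Suc k) - 1) gchoose Suc k = 0" for k
    using binomial_gbinomial[of k "Suc k", where 'a = real] by (simp add: binomial_eq_0)
  ultimately show ?case by (cases m) auto
next
  case (Suc y)
  note outer = Suc.IH
  show ?case
  proof (induction m)
    case 0
    have "sorted_words (Suc y) 0 = {[]}" by (auto simp: sorted_words_def)
    then show ?case by simp
  next
    case (Suc m)
    have disj: "(\<lambda>w. w @ [Suc y]) ` sorted_words (Suc y) m \<inter> sorted_words y (Suc m) = {}"
      by (auto simp: sorted_words_def)
    have "card (sorted_words (Suc y) (Suc m)) =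
        card (sorted_words (Suc y) m) + card (sorted_words y (Suc m))"
      unfolding sorted_words_Suc_Suc
      by (subst card_Un_disjoint[OF _ _ disj])
         (simp_all add: finite_sorted_words card_image inj_on_def)
    then have "real (card (sorted_words (Suc y) (Suc m))) =
        ((real y + real m) gchoose m) + ((real y + real m) gchoose Suc m)"
      using Suc.IH outer[of "Suc m"] by simp
    also have "\<dots> = (real y + real m + 1) gchoose Suc m"
      by (simp only: gbinomial_Suc_Suc)
    finally show ?case by (simp add: algebra_simps)
  qed
qed

section \<open>Kernel prefixes and the blocks between them\<close>

text \<open>The prefix of length \<open>r\<close> of a position whose third word has exactly \<open>m\<close> letters
  different from \<open>x\<close> is, for \<open>r \<ge> m\<close>, a kernel position iff \<open>kernel_prefix m u v r\<close>.
  Lengths below \<open>m\<close> are declared non-kernel since no move leads to them.\<close>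

function kernel_prefix :: "nat \<Rightarrow> nat list \<Rightarrow> nat list \<Rightarrow> nat \<Rightarrow> bool" where
  "kernel_prefix m u v r \<longleftrightarrow>
     m \<le> r \<and> (\<forall>a\<in>{..<r}. kernel_prefix m u v a \<longrightarrow> (\<exists>j\<in>{a..<r}. v ! j \<le> u ! a))"
  by pat_completeness auto
termination
  by (relation "measure (\<lambda>(m, u, v, r). r)") simp_all

declare kernel_prefix.simps [simp del]

lemma kernel_prefix_ge: "kernel_prefix m u v r \<Longrightarrow> m \<le> r"
  by (simp add: kernel_prefix.simps[of m u v r])

lemma kernel_prefixE:
  assumes "kernel_prefix m u v r" "kernel_prefix m u v a" "a < r"
  obtains j where "a \<le> j" "j < r" "v ! j \<le> u ! a"
proof -
  have "\<exists>j\<in>{a..<r}. v ! j \<le> u ! a"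
    using assms by (simp add: kernel_prefix.simps[of m u v r])
  then show ?thesis using that by auto
qed

lemma kernel_prefix_self: "kernel_prefix m u v m"
  using kernel_prefix_ge by (subst kernel_prefix.simps) fastforce

lemma kernel_prefix_cong:
  assumes "\<And>j. j < r \<Longrightarrow> u ! j = u' ! j" "\<And>j. j < r \<Longrightarrow> v ! j = v' ! j"
  shows "kernel_prefix m u v r \<longleftrightarrow> kernel_prefix m u' v' r"
  using assms
proof (induction r rule: less_induct)
  case (less r)
  have "kernel_prefix m u v a \<longleftrightarrow> kernel_prefix m u' v' a" if "a < r" for a
    using less that by simp
  then show ?case
    using less.prems by (simp add: kernel_prefix.simps[of _ _ _ r])
qed

text \<open>For \<open>a < n\<close>, this says that \<open>n\<close> is the first rank from which
  the bounds on \<open>u\<close> and \<open>v\<close> forbid a move to rank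
  \<open>a\<close>.\<close>

definition block_step :: "nat list \<Rightarrow> nat list \<Rightarrow> nat \<Rightarrow> nat \<Rightarrow> bool" where
  "block_step u v a n \<longleftrightarrow> (\<forall>j\<in>{a..<n - 1}. u ! a < v ! j) \<and> v ! (n - 1) \<le> u ! a"

text \<open>A kernel prefix strictly between \<open>a\<close> and \<open>n\<close> would need a
  letter of \<open>v\<close> that already blocks the move to \<open>a\<close>, but
  \<open>block_step\<close> puts the first such letter at index \<open>n - 1\<close>. Hence the
  \<open>a\<close> in \<open>kernel_prefix_iff\<close> is unique.\<close>

lemma block_step_largest:
  assumes "kernel_prefix m u v a" "block_step u v a n" "kernel_prefix m u v b" "b < n"
  shows "b \<le> a"
proof (rule ccontr)
  assume "\<not> b \<le> a"
  then obtain j where "a \<le> j" "j < b" "v ! j \<le> u ! a"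
    using kernel_prefixE[OF assms(3,1)] by auto
  then show False using assms(2,4) by (auto simp: block_step_def dest: bspec[of _ _ j])
qed

text \<open>The witness \<open>a\<close> is the largest kernel prefix below \<open>n\<close>.
  Conversely, a kernel prefix \<open>b < a\<close> is blocked already below \<open>a\<close>, and
  \<open>a\<close> itself is blocked at index \<open>n - 1\<close>.\<close>

lemma kernel_prefix_iff:
  assumes "m < n"
  shows "kernel_prefix m u v n \<longleftrightarrow>
    (\<exists>a\<in>{m..<n}. kernel_prefix m u v a \<and> block_step u v a n)"
proof
  assume n: "kernel_prefix m u v n"
  define S where "S = {a. a < n \<and> kernel_prefix m u v a}"
  define a where "a = Max S"
  have "finite S" "m \<in> S" using assms by (auto simp: S_def kernel_prefix_self)
  then have aS: "a \<in> S" and max: "\<And>b. b \<in> S \<Longrightarrow> b \<le> a"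
    unfolding a_def by (auto intro: Max_in)
  have a: "a < n" "kernel_prefix m u v a" using aS by (auto simp: S_def)
  \<comment> \<open>A blocking index \<open>j < n - 1\<close> for \<open>a\<close> would make
    \<open>Suc j\<close> a kernel prefix: \<open>j\<close> blocks \<open>a\<close>, and every kernel
    prefix below \<open>a\<close> is blocked before \<open>a\<close>. This contradicts the
    maximality of \<open>a\<close>.\<close>
  have last: "j = n - 1" if j: "a \<le> j" "j < n" "v ! j \<le> u ! a" for j
  proof (rule ccontr)
    assume "j \<noteq> n - 1"
    then have "Suc j < n" using j by simp
    have "\<exists>i\<in>{b..<Suc j}. v ! i \<le> u ! b" if b: "b < Suc j" "kernel_prefix m u v b" for b
    proof (cases "b = a")
      case True
      then show ?thesis using j by auto
    next
      case False
      then have "b < a" using max[of b] b \<open>Suc j < n\<close> by (auto simp: S_def)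
      then show ?thesis
        using kernel_prefixE[OF a(2) b(2)] j(1) by (metis atLeastLessThan_iff le_trans less_imp_le_nat less_Suc_eq_le)
    qed
    then have "kernel_prefix m u v (Suc j)"
      using kernel_prefix_ge[OF a(2)] j(1) by (subst kernel_prefix.simps) auto
    then show False using max[of "Suc j"] \<open>Suc j < n\<close> j(1) by (simp add: S_def)
  qed
  obtain j where "a \<le> j" "j < n" "v ! j \<le> u ! a"
    using kernel_prefixE[OF n a(2,1)] .
  then have "v ! (n - 1) \<le> u ! a" using last by metis
  moreover have "u ! a < v ! j" if "a \<le> j" "j < n - 1" for j
  proof (rule ccontr)
    assume "\<not> u ! a < v ! j"
    then have "j = n - 1" using last[of j] that by linarith
    then show False using that by simp
  qed
  ultimately show "\<exists>a\<in>{m..<n}. kernel_prefix m u v a \<and> block_step u v a n"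
    using a kernel_prefix_ge[OF a(2)] by (auto simp: block_step_def)
next
  assume "\<exists>a\<in>{m..<n}. kernel_prefix m u v a \<and> block_step u v a n"
  then obtain a where a: "a < n" "kernel_prefix m u v a" "block_step u v a n" by auto
  have "\<exists>j\<in>{b..<n}. v ! j \<le> u ! b" if b: "b < n" "kernel_prefix m u v b" for b
  proof (cases "b = a")
    case True
    then show ?thesis using a by (auto simp: block_step_def intro!: bexI[of _ "n - 1"])
  next
    case False
    then have "b < a" using block_step_largest[OF a(2,3) b(2,1)] by simp
    then show ?thesis
      using kernel_prefixE[OF a(2) b(2)] a(1) by (metis atLeastLessThan_iff less_trans)
  qed
  then show "kernel_prefix m u v n" using assms by (subst kernel_prefix.simps) auto
qed

section \<open>Recursion for the number of kernel pairs\<close>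

definition kernel_pairs :: "nat \<Rightarrow> nat \<Rightarrow> (nat list \<times> nat list) set" where
  "kernel_pairs m n = {(u, v). u \<in> words (\<lambda>i. {1..i + 1}) n \<and>
     v \<in> words (\<lambda>i. {1..i + 2}) n \<and> kernel_prefix m u v n}"

text \<open>A block is the part of both words from index \<open>a\<close> on, reindexed to start at
  0; the alphabets keep the offset \<open>a\<close>.\<close>

definition blocks :: "nat \<Rightarrow> nat \<Rightarrow> (nat list \<times> nat list) set" where
  "blocks a n = {(u, v). u \<in> words (\<lambda>i. {1..a + i + 1}) (n - a) \<and>
     v \<in> words (\<lambda>i. {1..a + i + 2}) (n - a) \<and> block_step u v 0 (n - a)}"

lemma finite_kernel_pairs: "finite (kernel_pairs m n)"
  by (rule finite_subset[OF _ finite_cartesian_product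
        [OF finite_words[of n "\<lambda>i. {1..i + 1}"] finite_words[of n "\<lambda>i. {1..i + 2}"]]])
     (auto simp: kernel_pairs_def)

definition last_kernel_at :: "nat \<Rightarrow> nat \<Rightarrow> nat \<Rightarrow> (nat list \<times> nat list) set" where
  "last_kernel_at m n a = {(u, v). u \<in> words (\<lambda>i. {1..i + 1}) n \<and>
     v \<in> words (\<lambda>i. {1..i + 2}) n \<and> kernel_prefix m u v a \<and> block_step u v a n}"

lemma block_step_append:
  assumes "length p = a" "length q = a" "a < n"
  shows "block_step (p @ u) (q @ v) a n \<longleftrightarrow> block_step u v 0 (n - a)"
proof -
  have "(\<forall>j\<in>{a..<n - 1}. (p @ u) ! a < (q @ v) ! j) \<longleftrightarrow> (\<forall>j\<in>{0..<n - a - 1}. u ! 0 < v ! j)"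
    (is "?L \<longleftrightarrow> ?R")
  proof
    assume L: ?L
    show ?R
    proof
      fix j assume "j \<in> {0..<n - a - 1}"
      then show "u ! 0 < v ! j"
        using L[rule_format, of "a + j"] assms by (auto simp: nth_append)
    qed
  next
    assume R: ?R
    show ?L
    proof
      fix j assume "j \<in> {a..<n - 1}"
      then show "(p @ u) ! a < (q @ v) ! j"
        using R[rule_format, of "j - a"] assms by (auto simp: nth_append)
    qed
  qed
  moreover have "(q @ v) ! (n - 1) = v ! (n - a - 1)" "(p @ u) ! a = u ! 0"
    using assms by (auto simp: nth_append)
  ultimately show ?thesis by (simp add: block_step_def)
qed

text \<open>Being a kernel prefix of length \<open>a\<close> depends only on the first
  \<open>a\<close> letters and the block condition only on the remaining ones, so the two parts can
  be chosen independently.\<close>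

lemma last_kernel_at_eq:
  assumes "a < n"
  shows "last_kernel_at m n a =
    (\<lambda>((p, q), (u, v)). (p @ u, q @ v)) ` (kernel_pairs m a \<times> blocks a n)" (is "?A = ?f ` ?B")
proof -
  have split: "words A n = (\<lambda>(l, l'). l @ l') ` (words A a \<times> words (\<lambda>i. A (a + i)) (n - a))" for A
    using words_append[of A a "n - a"] assms by simp
  have prefix: "kernel_prefix m (p @ u) (q @ v) a \<longleftrightarrow> kernel_prefix m p q a"
    if "length p = a" "length q = a" for p q u v
    using that by (intro kernel_prefix_cong) (auto simp: nth_append)
  have mem: "(p @ u, q @ v) \<in> ?A \<longleftrightarrow> ((p, q), (u, v)) \<in> ?B"
    if "p \<in> words (\<lambda>i. {1..i + 1}) a" "q \<in> words (\<lambda>i. {1..i + 2}) a"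
       "u \<in> words (\<lambda>i. {1..a + i + 1}) (n - a)" "v \<in> words (\<lambda>i. {1..a + i + 2}) (n - a)"
    for p q u v
  proof -
    have "p @ u \<in> words (\<lambda>i. {1..i + 1}) n" "q @ v \<in> words (\<lambda>i. {1..i + 2}) n"
      using that unfolding split by auto
    moreover have "length p = a" "length q = a" using that by (auto simp: words_def)
    ultimately show ?thesis
      using that block_step_append[of p a q n u v] prefix[of p q u v] assms
      by (simp add: last_kernel_at_def kernel_pairs_def blocks_def)
  qed
  show ?thesis
  proof (intro subset_antisym subsetI)
    fix z assume z: "z \<in> ?A"
    obtain U V where UV: "z = (U, V)" by (cases z)
    obtain p u q v where pu: "U = p @ u" "V = q @ v"
       "p \<in> words (\<lambda>i. {1..i + 1}) a" "q \<in> words (\<lambda>i. {1..i + 2}) a"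
       "u \<in> words (\<lambda>i. {1..a + i + 1}) (n - a)" "v \<in> words (\<lambda>i. {1..a + i + 2}) (n - a)"
      using z unfolding UV last_kernel_at_def split by auto
    then have "((p, q), (u, v)) \<in> ?B" using mem[of p q u v] z UV by simp
    then show "z \<in> ?f ` ?B" unfolding UV pu by force
  next
    fix z assume "z \<in> ?f ` ?B"
    then obtain p q u v where "((p, q), (u, v)) \<in> ?B" "z = (p @ u, q @ v)" by auto
    then show "z \<in> ?A" using mem[of p q u v] by (auto simp: kernel_pairs_def blocks_def)
  qed
qed

lemma card_last_kernel_at:
  assumes "a < n"
  shows "card (last_kernel_at m n a) = card (kernel_pairs m a) * card (blocks a n)"
proof -
  have "inj_on (\<lambda>((p, q), (u, v)). (p @ u, q @ v)) (kernel_pairs m a \<times> blocks a n)"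
  proof -
    have "length p = a \<and> length q = a" if "(p, q) \<in> kernel_pairs m a" for p q
      using that by (simp add: kernel_pairs_def words_def)
    then show ?thesis by (fastforce simp: inj_on_def)
  qed
  then show ?thesis
    unfolding last_kernel_at_eq[OF assms] by (simp add: card_image card_cartesian_product)
qed

text \<open>Classification by the last kernel prefix \<open>a\<close> before \<open>n\<close>: it
  exists by \<open>kernel_prefix_iff\<close> and is unique by
  \<open>block_step_largest\<close>.\<close>

lemma card_kernel_pairs_rec:
  assumes "m < n"
  shows "card (kernel_pairs m n) = (\<Sum>a\<in>{m..<n}. card (kernel_pairs m a) * card (blocks a n))"
proof -
  have eq: "kernel_pairs m n = (\<Union>a\<in>{m..<n}. last_kernel_at m n a)"
    using kernel_prefix_iff[OF assms] by (auto simp: kernel_pairs_def last_kernel_at_def)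
  have "last_kernel_at m n a \<inter> last_kernel_at m n b = {}"
    if "a \<in> {m..<n}" "b \<in> {m..<n}" "a \<noteq> b" for a b
  proof -
    have "a = b" if "(u, v) \<in> last_kernel_at m n a" "(u, v) \<in> last_kernel_at m n b" for u v
      using that \<open>a \<in> {m..<n}\<close> \<open>b \<in> {m..<n}\<close>
        block_step_largest[of m u v a n b] block_step_largest[of m u v b n a]
      by (auto simp: last_kernel_at_def)
    then show ?thesis using \<open>a \<noteq> b\<close> by auto
  qed
  moreover have "finite (last_kernel_at m n a)" if "a \<in> {m..<n}" for a
    by (rule finite_subset[OF _ finite_kernel_pairs[of m n]]) (use that eq in blast)
  ultimately have "card (kernel_pairs m n) = (\<Sum>a\<in>{m..<n}. card (last_kernel_at m n a))"
    unfolding eq by (intro card_UN_disjoint) auto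
  then show ?thesis by (simp add: card_last_kernel_at)
qed

lemma card_kernel_pairs_self: "card (kernel_pairs m m) = fact m * fact (m + 1)"
proof -
  have "kernel_pairs m m = words (\<lambda>i. {1..i + 1}) m \<times> words (\<lambda>i. {1..i + 2}) m"
    by (auto simp: kernel_pairs_def kernel_prefix_self)
  moreover have "(\<Prod>i<k. i + 1) = fact k" "(\<Prod>i<k. i + 2) = fact (k + 1)" for k :: nat
    by (induction k) (simp_all add: algebra_simps)
  ultimately show ?thesis by (simp add: card_cartesian_product card_words)
qed

section \<open>Counting the blocks\<close>

lemma prod_shift_eq_fact_choose: "(\<Prod>i<e. c + i + 1) = fact e * ((c + e) choose e)" for c e :: nat
proof -
  have "fact c * (\<Prod>i<e. c + i + 1) = fact (c + e)"
    by (induction e) (simp_all add: algebra_simps)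
  moreover have "fact (c + e) = fact c * (fact e * ((c + e) choose e))"
    using binomial_fact_lemma[of e "c + e"] by (simp add: algebra_simps)
  ultimately show ?thesis by simp
qed

text \<open>Replacing \<open>a\<close> by \<open>Suc a\<close> raises every weight by one, so the
  increment is an ordinary hockey-stick sum. The term \<open>s = Suc a\<close> has old weight
  0.\<close>

lemma sum_weighted_choose:
  "(\<Sum>s\<le>a. (a + 1 - s) * ((s + e) choose e)) = (a + e + 2) choose (e + 2)" for a e :: nat
proof (induction a)
  case 0
  then show ?case by simp
next
  case (Suc a)
  have hockey: "(\<Sum>s\<le>b. (s + e) choose e) = (b + e + 1) choose (e + 1)" for b
    by (induction b) simp_all
  have "(\<Sum>s\<le>Suc a. (Suc a + 1 - s) * ((s + e) choose e)) =
      (\<Sum>s\<le>Suc a. (a + 1 - s) * ((s + e) choose e) + ((s + e) choose e))"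
    by (intro sum.cong refl) (simp add: Suc_diff_le)
  also have "\<dots> = (\<Sum>s\<le>a. (a + 1 - s) * ((s + e) choose e)) + (\<Sum>s\<le>Suc a. (s + e) choose e)"
    by (simp add: sum.distrib)
  also have "\<dots> = ((a + e + 2) choose (e + 2)) + ((Suc a + e + 1) choose (e + 1))"
    unfolding hockey Suc.IH ..
  finally show ?case by simp
qed

text \<open>Once \<open>t = u ! 0\<close> is fixed, the conditions on the letters of
  \<open>u\<close> and \<open>v\<close> become independent. The last letter of \<open>v\<close>
  needs no bound besides \<open>t\<close>, since \<open>t\<close> is at most
  \<open>a + 1\<close>.\<close>

lemma blocks_eq:
  "blocks a (a + Suc e) = (\<Union>t\<in>{1..a + 1}.
     words (\<lambda>i. if i = 0 then {t} else {1..a + i + 1}) (Suc e) \<times>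
     words (\<lambda>i. if i = e then {1..t} else {t + 1..a + i + 2}) (Suc e))" (is "_ = (\<Union>t\<in>_. ?P t)")
proof (intro subset_antisym subsetI)
  fix z assume z: "z \<in> blocks a (a + Suc e)"
  obtain u v where uv: "z = (u, v)" by (cases z)
  have "u ! 0 \<in> {1..a + 1}"
    using z unfolding uv by (auto simp: blocks_def words_def dest: spec[of _ 0])
  moreover have "z \<in> ?P (u ! 0)"
    using z unfolding uv by (auto simp: blocks_def words_def block_step_def Suc_le_eq)
  ultimately show "z \<in> (\<Union>t\<in>{1..a + 1}. ?P t)" by blast
next
  fix z assume "z \<in> (\<Union>t\<in>{1..a + 1}. ?P t)"
  then obtain t u v where t: "t \<in> {1..a + 1}" and uv: "z = (u, v)"
    and u: "u \<in> words (\<lambda>i. if i = 0 then {t} else {1..a + i + 1}) (Suc e)"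
    and v: "v \<in> words (\<lambda>i. if i = e then {1..t} else {t + 1..a + i + 2}) (Suc e)" by auto
  have len: "length u = Suc e" "length v = Suc e" using u v by (auto simp: words_def)
  have u0: "u ! 0 = t" using u by (auto simp: words_def)
  have ui: "u ! i \<in> {1..a + i + 1}" if "i < Suc e" for i
    using u t that by (cases "i = 0") (auto simp: words_def)
  have ve: "v ! e \<in> {1..t}" using v by (auto simp: words_def)
  have vi: "v ! i \<in> {t + 1..a + i + 2}" if "i < e" for i
  proof -
    have "v ! i \<in> (if i = e then {1..t} else {t + 1..a + i + 2})"
      using v that unfolding words_def mem_Collect_eq by (meson less_SucI)
    then show ?thesis using that by simp
  qed
  have "v ! i \<in> {1..a + i + 2}" if "i < Suc e" for i
    using vi[of i] ve t that by (cases "i = e") auto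
  then have "u \<in> words (\<lambda>i. {1..a + i + 1}) (Suc e)" "v \<in> words (\<lambda>i. {1..a + i + 2}) (Suc e)"
    using ui len unfolding words_def by blast+
  moreover have "block_step u v 0 (Suc e)"
    using u0 ve vi by (fastforce simp: block_step_def)
  ultimately show "z \<in> blocks a (a + Suc e)" by (simp add: uv blocks_def)
qed

lemma card_blocks:
  assumes "a < n"
  shows "card (blocks a n) =
    (fact (n - a - 1))\<^sup>2 * (n choose (a + 1)) * ((n + 1) choose a)"
proof -
  obtain e where n: "n = a + Suc e" using assms less_iff_Suc_add by auto
  define A where "A t = words (\<lambda>i. if i = 0 then {t} else {1..a + i + 1}) (Suc e)" for t
  define B where "B t = words (\<lambda>i. if i = e then {1..t} else {t + 1..a + i + 2}) (Suc e)" for t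
  have cA: "card (A t) = fact e * ((a + 1 + e) choose e)" for t
    unfolding A_def card_words prod.lessThan_Suc_shift
    using prod_shift_eq_fact_choose[of "a + 1" e] by (simp add: algebra_simps)
  \<comment> \<open>With \<open>t = a + 1 - s\<close>, the alphabet
    \<open>{t + 1..a + i + 2}\<close> has \<open>s + i + 1\<close> letters, and the last letter of
    \<open>v\<close> has \<open>t\<close> choices.\<close>
  have cB: "card (B (a + 1 - s)) = fact e * ((a + 1 - s) * ((s + e) choose e))" if "s \<le> a" for s
  proof -
    have "card (B (a + 1 - s)) = (\<Prod>i<e. s + i + 1) * (a + 1 - s)"
      unfolding B_def card_words using that by (simp add: algebra_simps)
    then show ?thesis by (simp only: prod_shift_eq_fact_choose mult_ac)
  qed
  have "card (blocks a n) = (\<Sum>t\<in>{1..a + 1}. card (A t \<times> B t))"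
    unfolding n blocks_eq A_def[symmetric] B_def[symmetric]
  proof (rule card_UN_disjoint)
    show "\<forall>t\<in>{1..a + 1}. finite (A t \<times> B t)"
      by (auto simp: A_def B_def intro!: finite_cartesian_product finite_words)
    have "A s \<inter> A t = {}" if "s \<noteq> t" for s t
      using that by (auto simp: A_def words_def)
    then show "\<forall>s\<in>{1..a + 1}. \<forall>t\<in>{1..a + 1}. s \<noteq> t \<longrightarrow> A s \<times> B s \<inter> A t \<times> B t = {}"
      by blast
  qed simp
  also have "\<dots> = (\<Sum>s\<le>a. card (A (a + 1 - s)) * card (B (a + 1 - s)))"
    by (rule sum.reindex_bij_witness[of _ "\<lambda>s. a + 1 - s" "\<lambda>t. a + 1 - t"])
       (auto simp: card_cartesian_product)
  also have "\<dots> = (\<Sum>s\<le>a. (fact e)\<^sup>2 * ((a + 1 + e) choose e) * ((a + 1 - s) * ((s + e) choose e)))"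
    by (intro sum.cong refl) (simp add: cA cB[simplified] power2_eq_square)
  also have "\<dots> = (fact e)\<^sup>2 * ((a + 1 + e) choose e) * ((a + e + 2) choose (e + 2))"
    unfolding sum_weighted_choose[symmetric] by (simp only: sum_distrib_left)
  also have "(a + 1 + e) choose e = n choose (a + 1)"
    using binomial_symmetric[of e n] by (simp add: n)
  also have "(a + e + 2) choose (e + 2) = (n + 1) choose a"
    using binomial_symmetric[of a "n + 1"] by (simp add: n)
  finally show ?thesis by (simp add: n)
qed

section \<open>Weighted sums over index chains\<close>

definition chain_sum :: "(nat \<Rightarrow> nat \<Rightarrow> real) \<Rightarrow> nat \<Rightarrow> nat \<Rightarrow> nat \<Rightarrow> real" where
  "chain_sum b k m n = (\<Sum>i\<in>index_chains k m n. \<Prod>j = 0..k. b (i ! j) (i ! (j + 1)))"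

lemma index_chains_0: "index_chains 0 m n = (if m < n then {[m, n]} else {})"
  by (auto simp: index_chains_def numeral_2_eq_2 length_Suc_conv)

text \<open>Removing the last entry \<open>n\<close> leaves a chain that ends at the penultimate
  entry \<open>a\<close>.\<close>

lemma index_chains_Suc:
  "index_chains (Suc k) m n = (\<Union>a\<in>{m<..<n}. (\<lambda>i. i @ [n]) ` index_chains k m a)"
proof (intro subset_antisym subsetI)
  fix i assume i: "i \<in> index_chains (Suc k) m n"
  then obtain l b where l: "i = l @ [b]"
    by (cases i rule: rev_cases) (auto simp: index_chains_def)
  have len: "length l = k + 2" and b: "b = n"
    using i by (auto simp: index_chains_def l nth_append)
  have "sorted_wrt (<) l"
    using i by (simp add: index_chains_def l sorted_wrt_append)
  then have "l ! 0 < l ! (k + 1)"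
    using len by (simp add: sorted_wrt_iff_nth_less)
  moreover have "l ! (k + 1) < n"
    using i len b by (auto simp: index_chains_def l sorted_wrt_append)
  moreover have "l \<in> index_chains k m (l ! (k + 1))" "l ! 0 = m"
    using i len by (auto simp: index_chains_def l sorted_wrt_append nth_append)
  ultimately show "i \<in> (\<Union>a\<in>{m<..<n}. (\<lambda>i. i @ [n]) ` index_chains k m a)"
    unfolding l b by auto
next
  fix i assume "i \<in> (\<Union>a\<in>{m<..<n}. (\<lambda>i. i @ [n]) ` index_chains k m a)"
  then obtain a l where a: "a < n" and l: "l \<in> index_chains k m a" and i: "i = l @ [n]" by auto
  have "c < n" if c: "c \<in> set l" for c
  proof -
    have lk: "length l = k + 2" "sorted l" "l ! (k + 1) = a"
      using l by (simp_all add: index_chains_def strict_sorted_imp_sorted)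
    then obtain j where "j < k + 2" "c = l ! j"
      using c unfolding in_set_conv_nth by auto
    then show ?thesis
      using sorted_nth_mono[OF lk(2), of j "k + 1"] lk a by simp
  qed
  then show "i \<in> index_chains (Suc k) m n"
    using l by (simp add: index_chains_def i sorted_wrt_append nth_append)
qed

lemma chain_sum_0: "m < n \<Longrightarrow> chain_sum b 0 m n = b m n"
  by (simp add: chain_sum_def index_chains_0)

lemma chain_sum_Suc:
  "chain_sum b (Suc k) m n = (\<Sum>a\<in>{m<..<n}. chain_sum b k m a * b a n)"
proof -
  have finite: "finite ((\<lambda>i. i @ [n]) ` index_chains k m a)" for a
    by (simp add: finite_index_chains)
  have disjoint: "(\<lambda>i. i @ [n]) ` index_chains k m a \<inter> (\<lambda>i. i @ [n]) ` index_chains k m c = {}"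
    if "a \<noteq> c" for a c
    using that by (auto simp: index_chains_def)
  have "chain_sum b (Suc k) m n = (\<Sum>a\<in>{m<..<n}. \<Sum>i\<in>(\<lambda>i. i @ [n]) ` index_chains k m a.
      \<Prod>j = 0..Suc k. b (i ! j) (i ! (j + 1)))"
    unfolding chain_sum_def index_chains_Suc using finite disjoint
    by (subst sum.UNION_disjoint) simp_all
  also have "\<dots> = (\<Sum>a\<in>{m<..<n}. \<Sum>i\<in>index_chains k m a.
      (\<Prod>j = 0..k. b (i ! j) (i ! (j + 1))) * b a n)"
  proof (rule sum.cong[OF refl])
    fix a
    have "(\<Prod>j = 0..Suc k. b ((i @ [n]) ! j) ((i @ [n]) ! (j + 1))) =
        (\<Prod>j = 0..k. b (i ! j) (i ! (j + 1))) * b a n" if "i \<in> index_chains k m a" for i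
      using that by (auto simp: index_chains_def nth_append intro!: prod.cong)
    then show "(\<Sum>i\<in>(\<lambda>i. i @ [n]) ` index_chains k m a.
        \<Prod>j = 0..Suc k. b (i ! j) (i ! (j + 1))) =
        (\<Sum>i\<in>index_chains k m a. (\<Prod>j = 0..k. b (i ! j) (i ! (j + 1))) * b a n)"
      by (subst sum.reindex) (auto simp: inj_on_def intro!: sum.cong)
  qed
  finally show ?thesis by (simp add: chain_sum_def sum_distrib_right)
qed

lemma chain_sum_eq_0: "n \<le> m + k \<Longrightarrow> chain_sum b k m n = 0"
proof (induction k arbitrary: n)
  case 0
  then show ?case by (simp add: chain_sum_def index_chains_0)
next
  case (Suc k)
  then show ?case by (simp add: chain_sum_Suc)
qed

definition all_chain_sum :: "(nat \<Rightarrow> nat \<Rightarrow> real) \<Rightarrow> nat \<Rightarrow> nat \<Rightarrow> real" where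
  "all_chain_sum b m n = (\<Sum>k = 0..n - m - 1. chain_sum b k m n)"

text \<open>Chains with too many steps do not exist, so the sum can be padded with zeros to a range
  that is the same for all endpoints.\<close>

lemma all_chain_sum_extend:
  assumes "m < n" "n \<le> m + N"
  shows "all_chain_sum b m n = (\<Sum>k<N. chain_sum b k m n)"
  unfolding all_chain_sum_def
proof (rule sum.mono_neutral_left)
  show "{0..n - m - 1} \<subseteq> {..<N}" using assms by auto
  show "\<forall>k\<in>{..<N} - {0..n - m - 1}. chain_sum b k m n = 0"
    by (intro ballI chain_sum_eq_0) auto
qed simp

text \<open>A chain is either the single step from \<open>m\<close> to \<open>n\<close> or a chain
  to some intermediate \<open>a\<close> followed by the step from \<open>a\<close> to
  \<open>n\<close>.\<close>

lemma all_chain_sum_rec: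
  assumes "m < n"
  shows "all_chain_sum b m n = b m n + (\<Sum>a\<in>{m<..<n}. all_chain_sum b m a * b a n)"
proof -
  \<comment> \<open>After the term \<open>k = 0\<close> is split off, the range \<open>k<n\<close>
    remains, which is long enough for every endpoint \<open>a < n\<close>; so the two sums can be
    swapped.\<close>
  have "all_chain_sum b m n = (\<Sum>k<Suc n. chain_sum b k m n)"
    using assms by (intro all_chain_sum_extend) auto
  also have "\<dots> = b m n + (\<Sum>k<n. \<Sum>a\<in>{m<..<n}. chain_sum b k m a * b a n)"
    unfolding sum.lessThan_Suc_shift using assms by (simp add: chain_sum_0 chain_sum_Suc)
  also have "(\<Sum>k<n. \<Sum>a\<in>{m<..<n}. chain_sum b k m a * b a n) =
      (\<Sum>a\<in>{m<..<n}. \<Sum>k<n. chain_sum b k m a * b a n)"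
    by (rule sum.swap)
  also have "\<dots> = (\<Sum>a\<in>{m<..<n}. all_chain_sum b m a * b a n)"
    by (intro sum.cong refl) (simp add: all_chain_sum_extend[where N = n] sum_distrib_right)
  finally show ?thesis .
qed

definition block_count :: "nat \<Rightarrow> nat \<Rightarrow> real" where
  "block_count a n =
     (fact (n - a - 1))\<^sup>2 * real (n choose (a + 1)) * real ((n + 1) choose a)"

text \<open>Both sides satisfy the same recursion over the last step. The term \<open>a = m\<close>
  contributes the starting value \<open>fact m * fact (m + 1)\<close>, as every pair of words of
  length \<open>m\<close> counts there.\<close>

lemma card_kernel_pairs:
  assumes "m < n"
  shows "real (card (kernel_pairs m n)) =
    fact m * fact (m + 1) * all_chain_sum block_count m n"
  using assms
proof (induction n rule: less_induct)
  case (less n)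
  have blk: "real (card (blocks a n)) = block_count a n" if "a < n" for a
    using that by (simp add: card_blocks block_count_def)
  have "real (card (kernel_pairs m n)) =
      (\<Sum>a\<in>{m..<n}. real (card (kernel_pairs m a)) * block_count a n)"
    using less.prems by (simp add: card_kernel_pairs_rec blk)
  also have "{m..<n} = insert m {m<..<n}" using less.prems by auto
  also have "(\<Sum>a\<in>insert m {m<..<n}. real (card (kernel_pairs m a)) * block_count a n) =
      fact m * fact (m + 1) * block_count m n +
      (\<Sum>a\<in>{m<..<n}. fact m * fact (m + 1) * (all_chain_sum block_count m a * block_count a n))"
    by (subst sum.insert) (simp_all add: card_kernel_pairs_self less.IH mult.assoc algebra_simps)
  also have "\<dots> = fact m * fact (m + 1) * all_chain_sum block_count m n"
    unfolding all_chain_sum_rec[OF less.prems] sum_distrib_left[symmetric]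
    by (simp only: distrib_left)
  finally show ?case .
qed

section \<open>From the game to kernel pairs\<close>

lemma sorted_eq_append_replicate:
  assumes "sorted w" "set w \<subseteq> {1..x}" "length w = n"
  obtains m w' where "m \<le> n" "w' \<in> sorted_words (x - 1) m" "w = w' @ replicate (n - m) x"
proof -
  define w' where "w' = takeWhile (\<lambda>c. c < x) w"
  define r where "r = dropWhile (\<lambda>c. c < x) w"
  have w: "w = w' @ r" by (simp add: w'_def r_def)
  have "c = x" if c: "c \<in> set r" for c
  proof -
    have "r \<noteq> []" using c by auto
    then have "x \<le> hd r" using hd_dropWhile[of "\<lambda>c. c < x" w] by (simp add: r_def)
    moreover have "sorted r" using assms(1) by (simp add: w sorted_append)
    then have "hd r \<le> c" using c by (cases r) auto
    moreover have "c \<le> x" using c assms(2) by (auto simp: w)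
    ultimately show ?thesis by simp
  qed
  then have "r = replicate (length r) x" by (metis replicate_length_same)
  then have "w = w' @ replicate (n - length w') x" using w assms(3) by auto
  moreover have "set w' \<subseteq> {1..x - 1}"
    using assms(2) set_takeWhileD[of _ "\<lambda>c. c < x" w] by (fastforce simp: w'_def)
  then have "w' \<in> sorted_words (x - 1) (length w')"
    using assms(1) by (auto simp: sorted_words_def w sorted_append)
  moreover have "length w' \<le> n" using assms(3) w by auto
  ultimately show ?thesis using that by blast
qed

text \<open>Strong induction on \<open>r\<close>: a move may delete only letters \<open>x\<close> of
  the third word, hence reaches only ranks \<open>a\<close> with \<open>m \<le> a\<close>, and there
  the recursion for Grundy number zero is that of \<open>kernel_prefix\<close>.\<close>

lemma grundy_prefix_eq_0_iff:
  assumes w': "w' \<in> sorted_words (x - 1) m" and "x \<ge> 1"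
    and len: "length u = n" "length v = n" and r: "m \<le> r" "r \<le> n"
  shows "grundy x (take r u, take r v, take r (w' @ replicate (n - m) x)) = 0 \<longleftrightarrow>
    kernel_prefix m u v r"
  using r
proof (induction r rule: less_induct)
  case (less r)
  define w where "w = w' @ replicate (n - m) x"
  let ?p = "\<lambda>r. (take r u, take r v, take r w)"
  have lenw': "length w' = m" using w' by (simp add: sorted_words_def)
  \<comment> \<open>The letters of \<open>w'\<close> are at most \<open>x - 1\<close>, so the run of
    letters \<open>x\<close> starts exactly at index \<open>m\<close>.\<close>
  have wx: "w ! j = x \<longleftrightarrow> m \<le> j" if "j < n" for j
  proof (cases "m \<le> j")
    case True
    then show ?thesis using that lenw' by (simp add: w_def nth_append)
  next
    case False
    then have "w' ! j \<in> set w'" using lenw' by simp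
    then have "w' ! j \<in> {1..x - 1}" using w' by (auto simp: sorted_words_def)
    then show ?thesis using False lenw' \<open>x \<ge> 1\<close> by (auto simp: w_def nth_append)
  qed
  have range: "(\<forall>j\<in>{a + 1..r}. P (j - 1)) \<longleftrightarrow> (\<forall>j\<in>{a..<r}. P j)" for a P
  proof
    assume L: "\<forall>j\<in>{a + 1..r}. P (j - 1)"
    show "\<forall>j\<in>{a..<r}. P j"
    proof
      fix j assume "j \<in> {a..<r}"
      then show "P j" using L[rule_format, of "Suc j"] by simp
    qed
  next
    assume R: "\<forall>j\<in>{a..<r}. P j"
    show "\<forall>j\<in>{a + 1..r}. P (j - 1)"
    proof
      fix j assume "j \<in> {a + 1..r}"
      then have "j - 1 \<in> {a..<r}" by auto
      then show "P (j - 1)" using R by blast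
    qed
  qed
  have moves: "moves x (?p r) = ?p ` {a. a < r \<and> m \<le> a \<and> (\<forall>j\<in>{a..<r}. u ! a < v ! j)}"
  proof -
    have all_x: "(\<forall>j\<in>{a..<r}. w ! j = x) \<longleftrightarrow> m \<le> a" if "a < r" for a
      using wx less.prems that by auto
    have "take a (take r l) = take a l" "take r l ! a = l ! a" if "a < r"
      for a and l :: "nat list"
      using that by (simp_all add: min_def)
    moreover have "take r l ! (j - 1) = l ! (j - 1)" if "j \<in> {a + 1..r}"
      for l :: "nat list" and a j
      using that by (intro nth_take) auto
    ultimately have eq: "q = (take a (take r u), take a (take r v), take a (take r w)) \<and> a < r \<and>
        (\<forall>j\<in>{a + 1..r}. take r w ! (j - 1) = x) \<and>
        (\<forall>j\<in>{a + 1..r}. take r u ! a < take r v ! (j - 1)) \<longleftrightarrow>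
      q = ?p a \<and> a < r \<and> (\<forall>j\<in>{a + 1..r}. w ! (j - 1) = x) \<and>
        (\<forall>j\<in>{a + 1..r}. u ! a < v ! (j - 1))" for q a
      by (cases "a < r") (simp_all only: simp_thms cong: ball_cong)
    have "length (take r u) = r" using len less.prems by simp
    then have "moves x (?p r) = {?p a | a. a < r \<and> (\<forall>j\<in>{a + 1..r}. w ! (j - 1) = x) \<and>
        (\<forall>j\<in>{a + 1..r}. u ! a < v ! (j - 1))}"
      by (simp only: moves.simps eq)
    also have "\<dots> = {?p a | a. a < r \<and> (\<forall>j\<in>{a..<r}. w ! j = x) \<and> (\<forall>j\<in>{a..<r}. u ! a < v ! j)}"
      by (simp only: range[of _ "\<lambda>j. w ! j = x"] range[of _ "\<lambda>j. u ! _ < v ! j"])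
    also have "\<dots> = ?p ` {a. a < r \<and> m \<le> a \<and> (\<forall>j\<in>{a..<r}. u ! a < v ! j)}"
      using all_x by blast
    finally show ?thesis .
  qed
  have IH: "grundy x (?p a) = 0 \<longleftrightarrow> kernel_prefix m u v a" if "a < r" "m \<le> a" for a
    using less.IH[OF that] less.prems(2) that(1) by (simp add: w_def[symmetric])
  have "grundy x (?p r) = 0 \<longleftrightarrow>
      (\<forall>a. a < r \<and> m \<le> a \<and> (\<forall>j\<in>{a..<r}. u ! a < v ! j) \<longrightarrow> \<not> kernel_prefix m u v a)"
    unfolding grundy_eq_0_iff[of x "?p r"] moves using IH by blast
  \<comment> \<open>The definition of \<open>kernel_prefix\<close> ranges over all
    \<open>a < r\<close>, but those below \<open>m\<close> are never kernel prefixes.\<close>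
  also have "\<dots> \<longleftrightarrow> kernel_prefix m u v r"
    unfolding kernel_prefix.simps[of m u v r]
    using less.prems(1) kernel_prefix_ge[of m u v] by (auto simp: not_less[symmetric])
  finally show ?case by (simp add: w_def)
qed

lemma positions_alt:
  "positions x n = {(u, v, w). u \<in> words (\<lambda>i. {1..i + 1}) n \<and> v \<in> words (\<lambda>i. {1..i + 2}) n \<and>
     length w = n \<and> sorted w \<and> set w \<subseteq> {1..x}}"
proof -
  have shift: "(\<forall>i\<in>{1..n}. P (i - 1) i) \<longleftrightarrow> (\<forall>i<n. P i (Suc i))" for P
  proof
    assume L: "\<forall>i\<in>{1..n}. P (i - 1) i"
    show "\<forall>i<n. P i (Suc i)" using L[rule_format, of "Suc _"] by simp
  next
    assume R: "\<forall>i<n. P i (Suc i)"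
    show "\<forall>i\<in>{1..n}. P (i - 1) i"
    proof
      fix i assume "i \<in> {1..n}"
      then have "i - 1 < n" "Suc (i - 1) = i" by auto
      then show "P (i - 1) i" using R by metis
    qed
  qed
  have "(\<forall>i<n. 1 \<le> w ! i \<and> w ! i \<le> x) \<longleftrightarrow> set w \<subseteq> {1..x}" if "length w = n" for w :: "nat list"
    using that by (auto simp: set_conv_nth)
  then show ?thesis
    unfolding positions_def words_def
      shift[of "\<lambda>i j. 1 \<le> _ ! i \<and> _ ! i \<le> j"] shift[of "\<lambda>i j. 1 \<le> _ ! i \<and> _ ! i \<le> j + 1"]
      shift[of "\<lambda>i j. 1 \<le> _ ! i \<and> _ ! i \<le> x"]
    by auto
qed

lemma kernel_positions_eq:
  assumes "x \<ge> 1"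
  shows "kernel_positions x n = (\<Union>m\<in>{..n}.
    (\<lambda>(w, u, v). (u, v, w @ replicate (n - m) x)) ` (sorted_words (x - 1) m \<times> kernel_pairs m n))"
    (is "_ = (\<Union>m\<in>_. ?f m ` _)")
proof (intro subset_antisym subsetI)
  fix p assume p: "p \<in> kernel_positions x n"
  obtain u v w where uvw: "p = (u, v, w)" by (cases p)
  have uv: "u \<in> words (\<lambda>i. {1..i + 1}) n" "v \<in> words (\<lambda>i. {1..i + 2}) n"
    and w: "sorted w" "set w \<subseteq> {1..x}" "length w = n"
    and g: "grundy x (u, v, w) = 0"
    using p by (auto simp: kernel_positions_def positions_alt uvw)
  obtain m w' where m: "m \<le> n" "w' \<in> sorted_words (x - 1) m" and ww: "w = w' @ replicate (n - m) x"
    using sorted_eq_append_replicate[OF w] .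
  have "length u = n" "length v = n" using uv by (auto simp: words_def)
  then have "kernel_prefix m u v n"
    using grundy_prefix_eq_0_iff[OF m(2) assms, of u n v n] m(1) g w(3) by (simp add: ww[symmetric])
  then have "(w', u, v) \<in> sorted_words (x - 1) m \<times> kernel_pairs m n"
    using m uv by (simp add: kernel_pairs_def)
  then have "p \<in> ?f m ` (sorted_words (x - 1) m \<times> kernel_pairs m n)"
    by (rule rev_image_eqI) (simp add: uvw ww)
  then show "p \<in> (\<Union>m\<in>{..n}. ?f m ` (sorted_words (x - 1) m \<times> kernel_pairs m n))"
    using m(1) by blast
next
  fix p assume "p \<in> (\<Union>m\<in>{..n}. ?f m ` (sorted_words (x - 1) m \<times> kernel_pairs m n))"
  then obtain m w' u v where m: "m \<le> n" "w' \<in> sorted_words (x - 1) m"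
    and uv: "(u, v) \<in> kernel_pairs m n" and p: "p = (u, v, w' @ replicate (n - m) x)" by auto
  define w where "w = w' @ replicate (n - m) x"
  have lenuv: "length u = n" "length v = n" using uv by (auto simp: kernel_pairs_def words_def)
  have w: "length w = n" "sorted w" "set w \<subseteq> {1..x}"
    using m assms by (fastforce simp: w_def sorted_words_def sorted_append)+
  have "grundy x (u, v, w) = 0"
    using grundy_prefix_eq_0_iff[OF m(2) assms lenuv, of n] m(1) uv lenuv w(1)
    by (simp add: kernel_pairs_def w_def[symmetric])
  then show "p \<in> kernel_positions x n"
    using uv w by (auto simp: kernel_positions_def positions_alt kernel_pairs_def p w_def[symmetric])
qed

lemma card_kernel_positions:
  assumes "x \<ge> 1"
  shows "card (kernel_positions x n) =
    (\<Sum>m\<le>n. card (sorted_words (x - 1) m) * card (kernel_pairs m n))"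
proof -
  let ?f = "\<lambda>m (w, u, v). (u, v, w @ replicate (n - m) x)"
  let ?S = "\<lambda>m. sorted_words (x - 1) m \<times> kernel_pairs m n"
  \<comment> \<open>The number of letters different from \<open>x\<close> recovers \<open>m\<close>,
    so the families for distinct \<open>m\<close> are disjoint.\<close>
  have count: "length (filter (\<lambda>c. c \<noteq> x) (w @ replicate k x)) = m"
    if "w \<in> sorted_words (x - 1) m" for w m k
  proof -
    have "filter (\<lambda>c. c \<noteq> x) w = w"
      using that assms by (fastforce simp: sorted_words_def filter_id_conv)
    then show ?thesis using that by (simp add: sorted_words_def)
  qed
  have inj: "inj_on (?f m) (?S m)" for m by (auto simp: inj_on_def)
  have "?f m ` ?S m \<inter> ?f l ` ?S l = {}" if "m \<noteq> l" for m l
  proof -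
    have False if "w \<in> sorted_words (x - 1) m" "w' \<in> sorted_words (x - 1) l"
      "w @ replicate (n - m) x = w' @ replicate (n - l) x" for w w'
      using count[OF that(1)] count[OF that(2)] that(3) \<open>m \<noteq> l\<close> by metis
    then show ?thesis by (force simp: disjoint_iff)
  qed
  moreover have "finite (?f m ` ?S m)" for m
    by (simp add: finite_sorted_words finite_kernel_pairs)
  ultimately have "card (kernel_positions x n) = (\<Sum>m\<le>n. card (?f m ` ?S m))"
    unfolding kernel_positions_eq[OF assms]
    by (intro card_UN_disjoint) simp_all
  also have "\<dots> = (\<Sum>m\<le>n. card (sorted_words (x - 1) m) * card (kernel_pairs m n))"
    using inj by (simp add: card_image card_cartesian_product)
  finally show ?thesis .
qed

theorem theorem5p2:
  fixes x n :: nat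
  assumes "x \<ge> 1"
  shows "real (card (kernel_positions x n)) =
    (\<Sum>m<n. ((real x + real m - 2) gchoose m) * fact m * fact (m + 1) *
       (\<Sum>k = 0..n - m - 1. \<Sum>i\<in>index_chains k m n. \<Prod>j = 0..k.
          (fact (i ! (j + 1) - i ! j - 1))\<^sup>2 *
          real (i ! (j + 1) choose (i ! j + 1)) *
          real ((i ! (j + 1) + 1) choose (i ! j))))
    + ((real x + real n - 2) gchoose n) * fact n * fact (n + 1)"
proof -
  have sw: "real (card (sorted_words (x - 1) m)) = (real x + real m - 2) gchoose m" for m
  proof -
    have "real (x - 1) + real m - 1 = real x + real m - 2" using assms by simp
    then show ?thesis by (simp only: card_sorted_words)
  qed
  \<comment> \<open>The term \<open>m = n\<close> is split off because no chain leads from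
    \<open>n\<close> to \<open>n\<close>; it corresponds to third words without the letter
    \<open>x\<close>, from which no move exists.\<close>
  have "real (card (kernel_positions x n)) =
      (\<Sum>m<n. ((real x + real m - 2) gchoose m) * real (card (kernel_pairs m n))) +
      ((real x + real n - 2) gchoose n) * real (card (kernel_pairs n n))"
    unfolding card_kernel_positions[OF assms] lessThan_Suc_atMost[symmetric]
    by (simp add: sw[simplified])
  also have "\<dots> = (\<Sum>m<n. ((real x + real m - 2) gchoose m) * fact m * fact (m + 1) *
      all_chain_sum block_count m n) + ((real x + real n - 2) gchoose n) * fact n * fact (n + 1)"
    by (simp add: card_kernel_pairs card_kernel_pairs_self mult.assoc algebra_simps)
  finally show ?thesis
    unfolding all_chain_sum_def chain_sum_def block_count_def .
qed

end
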